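(* Let $p$ be a prime, let $a_1, a_2, \ldots \in \mathbb{Z}_p$ and let $r \in \mathbb{Z}_{> 0}$. The power series $(1 + a_1 x + a_2 x^2 + \ldots)^{1/p^r}$ has all its coefficients in $\mathbb{Z}_p$ if and only if \[ 1 + a_1 x + a_2 x^2 + \ldots \equiv (1 + a_{p^r} x + a_{2 p^r} x^2 + \ldots)^{p^r} \pmod{p^{r + 1}} . \]
   Context: $\mathbb{Z}_p$ denotes the ring of $p$-adic integers and $\mathbb{Q}_p$ its fraction field. For $f(x) = 1 + a_1 x + a_2 x^2 + \ldots \in 1 + x\mathbb{Q}_p[[x]]$ and $\lambda \in \mathbb{Q}_p$, the power $f(x)^{\lambda}$ is the formal power series defined by the binomial expansion $f(x)^\lambda = \sum_{n \ge 0} \binom{\lambda}{n} (a_1 x + a_2 x^2 + \ldots)^n$, where $\binom{\lambda}{n} = \lambda(\lambda-1)\cdots(\lambda-n+1)/n!$. For $A, B \in \mathbb{Q}_p[[x]]$, the notation $A \equiv B \pmod{p^k}$ means $A - B \in p^k \mathbb{Z}_p[[x]]$. *)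

theory Defs
  imports
    "HOL-Computational_Algebra.Polynomial_Factorial"
    "HOL-Computational_Algebra.Formal_Power_Series"
    "Berlekamp_Zassenhaus.Finite_Field"
begin

unbundle fps_syntax

text \<open>
  The prime \<open>p\<close> is carried by a type: \<open>p = CARD('p)\<close> with \<open>'p :: prime_card\<close>.  The
  \<open>p\<close>-adic integers are the inverse limit of the rings \<open>\<int>/p\<^sup>n\<close>: the element \<open>x\<close> is
  represented by the sequence of its residues modulo \<open>p\<^sup>n\<close>, each taken as the
  representative in \<open>{0..<p\<^sup>n}\<close> (the range condition follows from the compatibility
  condition, since \<open>f n\<close> is a value of \<open>_ mod p\<^sup>n\<close>).
\<close>

typedef (overloaded) 'p padic_int =
  "{f :: nat \<Rightarrow> int. \<forall>n. f (Suc n) mod int CARD('p::prime_card) ^ n = f n}"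
  by (rule exI[of _ "\<lambda>_. 0"]) simp

setup_lifting type_definition_padic_int

lemma mod_power_Suc_mod:
  "(x :: int) mod p ^ Suc n mod p ^ n = x mod p ^ n"
  by (rule mod_mod_cancel) (simp add: le_imp_power_dvd)

instantiation padic_int :: (prime_card) comm_ring_1
begin

lift_definition zero_padic_int :: "'a padic_int" is "\<lambda>_. 0" by simp

lift_definition one_padic_int :: "'a padic_int" is "\<lambda>n. 1 mod int CARD('a) ^ n"
  by (simp only: mod_power_Suc_mod)

lift_definition plus_padic_int :: "'a padic_int \<Rightarrow> 'a padic_int \<Rightarrow> 'a padic_int"
  is "\<lambda>x y n. (x n + y n) mod int CARD('a) ^ n"
  by (metis mod_add_eq mod_power_Suc_mod)

lift_definition minus_padic_int :: "'a padic_int \<Rightarrow> 'a padic_int \<Rightarrow> 'a padic_int"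
  is "\<lambda>x y n. (x n - y n) mod int CARD('a) ^ n"
  by (metis mod_diff_eq mod_power_Suc_mod)

lift_definition uminus_padic_int :: "'a padic_int \<Rightarrow> 'a padic_int"
  is "\<lambda>x n. (- x n) mod int CARD('a) ^ n"
  by (metis mod_minus_eq mod_power_Suc_mod)

lift_definition times_padic_int :: "'a padic_int \<Rightarrow> 'a padic_int \<Rightarrow> 'a padic_int"
  is "\<lambda>x y n. (x n * y n) mod int CARD('a) ^ n"
  by (metis mod_mult_eq mod_power_Suc_mod)

instance
proof
  fix a b c :: "'a padic_int"
  have red: "f n mod int CARD('a) ^ n = f n"
    if "\<forall>n. f (Suc n) mod int CARD('a) ^ n = f n" for f n
    by (metis that mod_mod_trivial)
  show "a + b + c = a + (b + c)"
    by transfer (simp add: mod_simps add.assoc)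
  show "a + b = b + a"
    by transfer (simp add: add.commute)
  show "0 + a = a"
    by transfer (simp add: red)
  show "- a + a = 0"
    by transfer (simp add: mod_simps)
  show "a - b = a + - b"
    by transfer (simp add: mod_simps)
  show "a * b * c = a * (b * c)"
    by transfer (simp add: mod_simps mult.assoc)
  show "a * b = b * a"
    by transfer (simp add: mult.commute)
  show "1 * a = a"
    by transfer (simp add: mod_simps red)
  show "(a + b) * c = a * c + b * c"
    by transfer (simp add: mod_simps distrib_right)
  have "1 mod int CARD('a) ^ 1 \<noteq> 0"
    using prime_card[where 'a = 'a] prime_gt_1_nat by (simp add: mod_pos_pos_trivial)
  then show "(0 :: 'a padic_int) \<noteq> 1"
    by transfer metis
qed

end

lemma padic_int_compat:
  assumes "\<forall>n. f (Suc n) mod int CARD('p::prime_card) ^ n = f n"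
  shows "f (n + k) mod int CARD('p) ^ n = f n"
proof (induction k)
  case 0
  then show ?case by (metis add_0_right assms mod_mod_trivial)
next
  case (Suc k)
  have "f (n + Suc k) mod int CARD('p) ^ n
      = f (Suc (n + k)) mod int CARD('p) ^ (n + k) mod int CARD('p) ^ n"
    by (simp add: mod_mod_cancel le_imp_power_dvd)
  also have "\<dots> = f (n + k) mod int CARD('p) ^ n" by (simp add: assms)
  finally show ?case using Suc by simp
qed

instance padic_int :: (prime_card) idom
proof
  fix a b :: "'a padic_int"
  assume "a \<noteq> 0" "b \<noteq> 0"
  then show "a * b \<noteq> 0"
  proof transfer
    fix x y :: "nat \<Rightarrow> int"
    let ?p = "int CARD('a)"
    assume x: "\<forall>n. x (Suc n) mod ?p ^ n = x n" and "x \<noteq> (\<lambda>_. 0)"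
      and y: "\<forall>n. y (Suc n) mod ?p ^ n = y n" and "y \<noteq> (\<lambda>_. 0)"
    obtain m where "x m \<noteq> 0" using \<open>x \<noteq> (\<lambda>_. 0)\<close> by (meson ext)
    obtain n where "y n \<noteq> 0" using \<open>y \<noteq> (\<lambda>_. 0)\<close> by (meson ext)
    have p: "prime ?p" using prime_card[where 'a = 'a] by simp
    have "\<not> ?p ^ m dvd x (m + n)" "\<not> ?p ^ n dvd y (n + m)"
      using padic_int_compat[OF x, of m n] padic_int_compat[OF y, of n m]
        \<open>x m \<noteq> 0\<close> \<open>y n \<noteq> 0\<close> by (auto simp: dvd_eq_mod_eq_0)
    then have nz: "x (m + n) \<noteq> 0" "y (m + n) \<noteq> 0"
      and "multiplicity ?p (x (m + n)) < m" "multiplicity ?p (y (m + n)) < n"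
      by (auto simp: add.commute multiplicity_dvd' not_le[symmetric])
    then have "multiplicity ?p (x (m + n) * y (m + n)) < m + n"
      using p by (subst prime_elem_multiplicity_mult_distrib) auto
    then have "\<not> ?p ^ (m + n) dvd x (m + n) * y (m + n)"
      using nz p by (subst power_dvd_iff_le_multiplicity) auto
    then show "(\<lambda>n. x n * y n mod ?p ^ n) \<noteq> (\<lambda>_. 0)"
      by (metis dvd_eq_mod_eq_0)
  qed
qed

lemma Rep_of_nat_padic_int:
  "Rep_padic_int (of_nat k :: 'p padic_int) n = int k mod int CARD('p::prime_card) ^ n"
  by (induction k) (simp_all add: zero_padic_int.rep_eq one_padic_int.rep_eq
        plus_padic_int.rep_eq mod_simps)

instance padic_int :: (prime_card) ring_char_0
proof
  show "inj (of_nat :: nat \<Rightarrow> 'a padic_int)"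
  proof (rule injI)
    fix j k assume eq: "(of_nat j :: 'a padic_int) = of_nat k"
    define n where "n = j + k"
    have "1 < CARD('a)" using prime_card[where 'a = 'a] prime_gt_1_nat by blast
    then have "2 ^ n \<le> CARD('a) ^ n" by (intro power_mono) auto
    then have "n < CARD('a) ^ n" by (rule less_le_trans[OF less_exp])
    then have "int j < int CARD('a) ^ n" "int k < int CARD('a) ^ n"
      unfolding n_def of_nat_power[symmetric] of_nat_less_iff by auto
    then show "j = k"
      using arg_cong[OF eq, of "\<lambda>x. Rep_padic_int x n"] by (simp add: Rep_of_nat_padic_int)
  qed
qed

instance fract :: ("{idom, ring_char_0}") field_char_0
proof
  show "inj (of_nat :: nat \<Rightarrow> 'a fract)"
    by (rule injI) (simp add: of_nat_fract eq_fract)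
qed

type_synonym 'p padic = "'p padic_int fract"

definition integral_fps :: "'p::prime_card padic fps \<Rightarrow> bool"
  where "integral_fps F \<longleftrightarrow> (\<forall>n. F $ n \<in> range to_fract)"

definition fps_cong :: "'p::prime_card padic fps \<Rightarrow> 'p padic fps \<Rightarrow> nat \<Rightarrow> bool"
  where "fps_cong A B k \<longleftrightarrow>
    (\<exists>C. integral_fps C \<and> A - B = fps_const (of_nat CARD('p) ^ k) * C)"

text \<open>
  \<open>F\<^sup>c\<close> for \<open>F\<close> with constant term \<open>1\<close>: the binomial series \<open>\<Sum>n. (c gchoose n) X\<^sup>n\<close> with
  \<open>F - 1\<close> substituted for \<open>X\<close>.  The lemma below confirms that this is the sum
  of the binomial expansion.
\<close>

definition fps_powr :: "'a::field_char_0 fps \<Rightarrow> 'a \<Rightarrow> 'a fps"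
  where "fps_powr F c = fps_binomial c oo (F - 1)"

lemma fps_powr_sums:
  assumes "F $ 0 = 1"
  shows "(\<lambda>n. fps_const (c gchoose n) * (F - 1) ^ n) sums fps_powr F c"
  unfolding sums_def
proof (rule tendsto_fpsI)
  fix k
  have zero: "(F - 1) ^ i $ k = 0" if "k < i" for i
    using assms that by (intro startsby_zero_power_prefix[rule_format]) auto
  show "\<forall>\<^sub>F n in sequentially.
      (\<Sum>i<n. fps_const (c gchoose i) * (F - 1) ^ i) $ k = fps_powr F c $ k"
    using eventually_gt_at_top[of k]
  proof eventually_elim
    case (elim n)
    have "(\<Sum>i<n. (c gchoose i) * (F - 1) ^ i $ k) = (\<Sum>i\<in>{0..k}. (c gchoose i) * (F - 1) ^ i $ k)"
      using elim by (intro sum.mono_neutral_right) (auto simp: zero)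
    then show ?case
      by (simp add: fps_sum_nth fps_powr_def fps_compose_nth)
  qed
qed

text \<open>The series \<open>1 + a\<^sub>d x + a\<^sub>2\<^sub>d x\<^sup>2 + \<dots>\<close>; the value \<open>a 0\<close> is ignored.\<close>

definition one_plus_series :: "(nat \<Rightarrow> 'p::prime_card padic_int) \<Rightarrow> nat \<Rightarrow> 'p padic fps"
  where "one_plus_series a d = Abs_fps (\<lambda>n. if n = 0 then 1 else to_fract (a (n * d)))"

end

theory Submission
  imports Defs
begin

text \<open>
  Write \<open>q = p\<^sup>r\<close>, \<open>F = 1 + a\<^sub>1 x + \<dots>\<close> and \<open>G = 1 + a\<^sub>q x + a\<^sub>2\<^sub>q x\<^sup>2 + \<dots>\<close>.  Congruences modulo
  \<open>p\<close> become congruences modulo \<open>p\<^sup>r\<^sup>+\<^sup>1\<close> after raising to the power \<open>q\<close>.  If \<open>F = H\<^sup>q\<close> with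
  \<open>H\<close> integral, then \<open>H\<^sup>q \<equiv> H(x\<^sup>q)\<close> modulo \<open>p\<close>; comparing the coefficients of \<open>x\<^sup>n\<^sup>q\<close> gives
  \<open>G \<equiv> H\<close> modulo \<open>p\<close>, hence \<open>G\<^sup>q \<equiv> F\<close> modulo \<open>p\<^sup>r\<^sup>+\<^sup>1\<close>.  Conversely, let \<open>H = F\<^sup>1\<^sup>/\<^sup>q\<close>.  The
  coefficient of \<open>x\<^sup>n\<close> in \<open>H\<^sup>q\<close> is \<open>q\<close> times that of \<open>H\<close> plus a contribution of the lower
  coefficients.  If these are integral and congruent modulo \<open>p\<close> to those of \<open>G\<close>, then
  their contributions to \<open>H\<^sup>q\<close> and \<open>G\<^sup>q\<close> agree modulo \<open>p q\<close>, so cancelling \<open>q\<close> shows that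
  the \<open>n\<close>-th coefficient of \<open>H\<close> is also integral and congruent to that of \<open>G\<close>.
\<close>

section \<open>Divisibility and powers in commutative rings and power series\<close>

lemma fps_of_nat_power_dvd_iff:
  fixes A :: "'a::comm_ring_1 fps"
  shows "of_nat m ^ k dvd A \<longleftrightarrow> (\<forall>n. of_nat m ^ k dvd A $ n)"
proof -
  have eq: "(of_nat m ^ k * C) $ n = of_nat m ^ k * C $ n" for C :: "'a fps" and n
    by (metis fps_mult_left_const_nth fps_of_nat of_nat_power)
  show ?thesis
  proof
    assume "of_nat m ^ k dvd A"
    then show "\<forall>n. of_nat m ^ k dvd A $ n"
      by (auto simp: dvd_def eq)
  next
    assume "\<forall>n. of_nat m ^ k dvd A $ n"
    then have "\<forall>n. \<exists>c. A $ n = of_nat m ^ k * c"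
      by (auto simp: dvd_def)
    then obtain c where c: "\<And>n. A $ n = of_nat m ^ k * c n" by metis
    then have "A = of_nat m ^ k * Abs_fps c"
      by (intro fps_ext) (simp add: eq)
    then show "of_nat m ^ k dvd A" by simp
  qed
qed

lemmas fps_of_nat_dvd_iff = fps_of_nat_power_dvd_iff[where k = 1, simplified]

lemma prime_dvd_power_add_diff:
  fixes a b :: "'a::comm_ring_1"
  assumes "prime p"
  shows "of_nat p dvd (a + b) ^ p - (a ^ p + b ^ p)"
proof -
  have p: "0 < p" using assms by (rule prime_gt_0_nat)
  have "(a + b) ^ p = (\<Sum>k\<le>p. of_nat (p choose k) * a ^ k * b ^ (p - k))"
    by (rule binomial_ring)
  also have "{..p} = insert 0 (insert p {0<..<p})" using p by auto
  also have "(\<Sum>k\<in>insert 0 (insert p {0<..<p}). of_nat (p choose k) * a ^ k * b ^ (p - k))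
      = a ^ p + b ^ p + (\<Sum>k\<in>{0<..<p}. of_nat (p choose k) * a ^ k * b ^ (p - k))"
    using p by simp
  finally have "(a + b) ^ p - (a ^ p + b ^ p)
      = (\<Sum>k\<in>{0<..<p}. of_nat (p choose k) * a ^ k * b ^ (p - k))"
    by simp
  also have "of_nat p dvd \<dots>"
  proof (rule dvd_sum)
    fix k assume "k \<in> {0<..<p}"
    then have "p dvd p choose k"
      using assms by (intro dvd_choose_prime) auto
    then show "of_nat p dvd of_nat (p choose k) * a ^ k * b ^ (p - k)"
      by (auto simp: dvd_def mult.assoc)
  qed
  finally show ?thesis .
qed

lemma dvd_diff_power:
  fixes a b :: "'a::comm_ring_1"
  assumes "d dvd a - b"
  shows "d dvd a ^ n - b ^ n"
  using assms by (simp add: power_diff_sumr2)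

text \<open>In \<open>a ^ p - b ^ p = (a - b) * (\<Sum>i<p. b ^ (p - Suc i) * a ^ i)\<close> the sum
  supplies the extra factor \<open>p\<close>: since a and b agree modulo \<open>p\<close>, it is
  congruent to \<open>p * b ^ (p - 1)\<close>.\<close>

lemma power_dvd_diff_power_prime:
  fixes a b :: "'a::comm_ring_1"
  assumes "of_nat p ^ Suc k dvd a - b"
  shows "of_nat p ^ Suc (Suc k) dvd a ^ p - b ^ p"
proof -
  have p: "of_nat p dvd a - b"
    using assms by (metis dvd_mult_left power_Suc)
  have "(\<Sum>i<p. b ^ (p - Suc i) * a ^ i) - of_nat p * b ^ (p - 1)
      = (\<Sum>i<p. b ^ (p - Suc i) * (a ^ i - b ^ i))"
  proof -
    have "(\<Sum>i<p. b ^ (p - Suc i) * b ^ i) = (\<Sum>i<p. b ^ (p - 1))"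
      by (intro sum.cong) (simp_all add: power_add[symmetric])
    then show ?thesis by (simp add: right_diff_distrib sum_subtractf)
  qed
  also have "of_nat p dvd \<dots>"
    using p by (intro dvd_sum dvd_mult dvd_diff_power)
  finally have "of_nat p dvd (\<Sum>i<p. b ^ (p - Suc i) * a ^ i)"
    by (metis dvd_triv_left diff_add_cancel dvd_add)
  then have "of_nat p ^ Suc k * of_nat p dvd (a - b) * (\<Sum>i<p. b ^ (p - Suc i) * a ^ i)"
    using assms by (intro mult_dvd_mono)
  then show ?thesis by (simp add: power_diff_sumr2 mult_ac)
qed

lemma power_dvd_diff_power_prime_power:
  fixes a b :: "'a::comm_ring_1"
  assumes "of_nat p dvd a - b"
  shows "of_nat p ^ Suc r dvd a ^ p ^ r - b ^ p ^ r"
proof (induction r)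
  case (Suc r)
  then show ?case
    using power_dvd_diff_power_prime[OF Suc] by (simp add: power_mult[symmetric] mult.commute)
qed (use assms in simp)

text \<open>\<open>H\<close> and its cutoff differ by a multiple of \<open>fps_X ^ n\<close>, so in
  the factored difference of the m-th powers only the constant term of the cofactor
  \<open>?S\<close> reaches degree n. It is m because both series have constant term 1; for the
  cutoff this uses \<open>n > 0\<close>.\<close>

lemma fps_power_nth_cutoff:
  fixes H :: "'a::comm_ring_1 fps"
  assumes "H $ 0 = 1" and "n > 0"
  shows "(H ^ m) $ n = of_nat m * H $ n + (fps_cutoff n H ^ m) $ n"
proof -
  let ?T = "fps_cutoff n H"
  let ?S = "\<Sum>i<m. ?T ^ (m - Suc i) * H ^ i"
  have "H - ?T = fps_X ^ n * fps_shift n H"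
    by (metis add_diff_cancel_right' fps_shift_cutoff mult.commute)
  then have "H ^ m - ?T ^ m = fps_X ^ n * (fps_shift n H * ?S)"
    by (simp add: power_diff_sumr2 mult.assoc)
  then have "(H ^ m - ?T ^ m) $ n = H $ n * ?S $ 0"
    by (simp add: fps_X_power_mult_nth)
  also have "?S $ 0 = of_nat m"
    using assms by (simp add: fps_sum_nth fps_power_zeroth)
  finally show ?thesis by (simp add: algebra_simps)
qed

section \<open>Fermat and Frobenius congruences over the p-adic integers\<close>

lemma Rep_power_padic_int:
  "Rep_padic_int (x ^ k :: 'p padic_int) n = Rep_padic_int x n ^ k mod int CARD('p::prime_card) ^ n"
  by (induction k) (simp_all add: one_padic_int.rep_eq times_padic_int.rep_eq mod_simps)

lemma of_nat_CARD_dvd_padic_int: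
  fixes x :: "'p::prime_card padic_int"
  assumes "Rep_padic_int x 1 = 0"
  shows "of_nat CARD('p) dvd x"
proof -
  let ?p = "int CARD('p)"
  let ?x = "Rep_padic_int x"
  have p: "?p > 0" by simp
  have x: "\<forall>n. ?x (Suc n) mod ?p ^ n = ?x n"
    using Rep_padic_int[of x] by simp
  have dvd: "?p dvd ?x (Suc n)" for n
    using padic_int_compat[OF x, of 1 n] assms by (simp add: dvd_eq_mod_eq_0)
  \<comment> \<open>The quotient modulo \<open>?p ^ n\<close> is determined by x modulo
    \<open>?p ^ Suc n\<close>, hence the index shift.\<close>
  define y :: "'p padic_int" where "y = Abs_padic_int (\<lambda>n. ?x (Suc n) div ?p)"
  have "?x (Suc (Suc n)) div ?p mod ?p ^ n = ?x (Suc n) div ?p" for n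
  proof -
    have "?p * (?x (Suc (Suc n)) div ?p mod ?p ^ n) = ?x (Suc (Suc n)) mod ?p ^ Suc n"
      using dvd[of "Suc n"] by (simp only: mult_mod_right power_Suc dvd_mult_div_cancel)
    also have "\<dots> = ?p * (?x (Suc n) div ?p)"
      using dvd[of n] x[rule_format, of "Suc n"] by simp
    finally show ?thesis using p by simp
  qed
  then have y: "Rep_padic_int y n = ?x (Suc n) div ?p" for n
    unfolding y_def by (subst Abs_padic_int_inverse) auto
  have "Rep_padic_int (of_nat CARD('p) * y) n = ?x n" for n
    using dvd[of n] x by (simp add: times_padic_int.rep_eq Rep_of_nat_padic_int y mod_simps)
  then have "of_nat CARD('p) * y = x"
    by (intro Rep_padic_int_inject[THEN iffD1] ext)
  then show ?thesis by (metis dvd_triv_left)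
qed

lemma fermat_padic_int:
  fixes x :: "'p::prime_card padic_int"
  shows "of_nat CARD('p) dvd x ^ CARD('p) - x"
proof (rule of_nat_CARD_dvd_padic_int)
  let ?p = "int CARD('p)"
  let ?k = "Rep_padic_int x 1"
  have "?p dvd int k ^ CARD('p) - int k" for k
  proof (induction k)
    case 0
    then show ?case by (simp add: zero_power)
  next
    case (Suc k)
    from dvd_add[OF this prime_dvd_power_add_diff[OF prime_card[where 'a = 'p], of "int k" 1]]
    show ?case by (simp add: algebra_simps)
  qed
  \<comment> \<open>The induction covers natural numbers only, so the residue has to be
    nonnegative.\<close>
  moreover have "?k \<ge> 0"
  proof -
    have "?k = Rep_padic_int x 2 mod ?p"
      using padic_int_compat[where 'p = 'p, of "Rep_padic_int x" 1 1] Rep_padic_int[of x] by (simp add: numeral_2_eq_2)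
    then show ?thesis by simp
  qed
  ultimately have "?p dvd ?k ^ CARD('p) - ?k"
    by (metis int_nat_eq)
  then show "Rep_padic_int (x ^ CARD('p) - x) 1 = 0"
    by (simp add: minus_padic_int.rep_eq Rep_power_padic_int mod_simps dvd_eq_mod_eq_0)
qed

text \<open>Peel off the constant term, \<open>A = A $ 0 + fps_X * B\<close>. Modulo
  \<open>p\<close> the p-th power is additive, so \<open>fps_X ^ p * B ^ p\<close> alone contributes
  in positive degrees and the claim passes to \<open>B\<close>. The constant term itself is Fermat's
  congruence.\<close>

lemma frobenius_fps_padic_int_prime:
  fixes A :: "'p::prime_card padic_int fps"
  shows "of_nat CARD('p) dvd (A ^ CARD('p)) $ (n * CARD('p)) - A $ n"
proof (induction n arbitrary: A)
  case 0
  then show ?case by (simp add: fps_power_zeroth fermat_padic_int)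
next
  case (Suc n)
  let ?p = "CARD('p)"
  define B where "B = fps_shift 1 A"
  have A: "A = fps_const (A $ 0) + fps_X * B"
    by (rule fps_ext) (auto simp: B_def)
  have "of_nat ?p dvd A ^ ?p - (fps_const ((A $ 0) ^ ?p) + fps_X ^ ?p * B ^ ?p)"
    using prime_dvd_power_add_diff[OF prime_card[where 'a = 'p], of "fps_const (A $ 0)" "fps_X * B"]
    by (simp flip: A add: power_mult_distrib fps_const_power)
  then have "of_nat ?p dvd (A ^ ?p - (fps_const ((A $ 0) ^ ?p) + fps_X ^ ?p * B ^ ?p)) $ (Suc n * ?p)"
    by (simp only: fps_of_nat_dvd_iff)
  then have "of_nat ?p dvd (A ^ ?p) $ (Suc n * ?p) - (B ^ ?p) $ (n * ?p)"
    by (simp add: fps_X_power_mult_nth)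
  from dvd_add[OF this Suc[of B]] show ?case by (simp add: B_def)
qed

lemma frobenius_fps_padic_int:
  fixes A :: "'p::prime_card padic_int fps"
  shows "of_nat CARD('p) dvd (A ^ CARD('p) ^ r) $ (n * CARD('p) ^ r) - A $ n"
proof (induction r arbitrary: n)
  case (Suc r)
  let ?p = "CARD('p)"
  have "of_nat ?p dvd ((A ^ ?p ^ r) ^ ?p) $ (n * ?p ^ r * ?p) - (A ^ ?p ^ r) $ (n * ?p ^ r)"
    by (rule frobenius_fps_padic_int_prime)
  from dvd_add[OF this Suc[of n]] show ?case
    by (simp add: power_mult[symmetric] mult_ac)
qed simp

section \<open>Transfer between integral series and the fraction field\<close>

definition fps_to_fract :: "'a::idom fps \<Rightarrow> 'a fract fps"
  where "fps_to_fract A = Abs_fps (\<lambda>n. to_fract (A $ n))"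

lemma fps_to_fract_nth [simp]: "fps_to_fract A $ n = to_fract (A $ n)"
  by (simp add: fps_to_fract_def)

lemma to_fract_of_nat: "to_fract (of_nat n) = of_nat n"
  by (induction n) auto

lemma to_fract_power: "to_fract (x ^ n) = to_fract x ^ n"
  by (induction n) auto

lemma fps_to_fract_power: "fps_to_fract (A ^ n) = fps_to_fract A ^ n"
proof (induction n)
  case 0
  then show ?case by (auto intro: fps_ext)
next
  case (Suc n)
  have "fps_to_fract (A * B) = fps_to_fract A * fps_to_fract B" for B
    by (rule fps_ext) (simp add: fps_mult_nth to_fract_sum)
  with Suc show ?case by simp
qed

lemma fps_to_fract_inject [simp]: "fps_to_fract A = fps_to_fract B \<longleftrightarrow> A = B"
  by (auto simp: fps_eq_iff)

lemma integral_fps_iff: "integral_fps F \<longleftrightarrow> (\<exists>A. F = fps_to_fract A)"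
proof
  assume "integral_fps F"
  then have "\<forall>n. \<exists>c. F $ n = to_fract c"
    by (auto simp: integral_fps_def image_iff)
  then obtain a where "\<And>n. F $ n = to_fract (a n)" by metis
  then have "F = fps_to_fract (Abs_fps a)" by (intro fps_ext) simp
  then show "\<exists>A. F = fps_to_fract A" by blast
qed (auto simp: integral_fps_def)

text \<open>Moves the congruence to the integral series, where divisibility by powers of
  \<open>p\<close> is meaningful; over the field every nonzero constant divides everything.\<close>

lemma fps_cong_to_fract_iff:
  fixes A B :: "'p::prime_card padic_int fps"
  shows "fps_cong (fps_to_fract A) (fps_to_fract B) k \<longleftrightarrow> of_nat CARD('p) ^ k dvd A - B"
proof -
  have "fps_to_fract A - fps_to_fract B = fps_const (of_nat CARD('p) ^ k) * fps_to_fract C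
      \<longleftrightarrow> A - B = of_nat CARD('p) ^ k * C" for C
  proof -
    have "of_nat CARD('p) ^ k * C = fps_const (of_nat CARD('p) ^ k) * C"
      by (simp add: fps_of_nat[symmetric] fps_const_power)
    moreover have "to_fract (A $ n) - to_fract (B $ n) = of_nat CARD('p) ^ k * to_fract (C $ n)
      \<longleftrightarrow> A $ n - B $ n = of_nat CARD('p) ^ k * C $ n" for n
      by (simp flip: to_fract_of_nat to_fract_power to_fract_mult to_fract_diff)
    ultimately show ?thesis by (simp add: fps_eq_iff)
  qed
  then show ?thesis by (auto simp: fps_cong_def integral_fps_iff dvd_def)
qed

section \<open>Roots of series and their integrality\<close>

lemma fps_powr_inverse_power:
  assumes "F $ 0 = 1" and "q > 0"
  shows "fps_powr F (1 / of_nat q) ^ q = F"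
proof -
  \<comment> \<open>Composition commutes with powers because \<open>F - 1\<close> has zero constant
    term.\<close>
  have "fps_powr F (1 / of_nat q) ^ q = fps_binomial (1 / of_nat q) ^ q oo (F - 1)"
    unfolding fps_powr_def using assms by (subst fps_compose_power) auto
  also have "fps_binomial (1 / of_nat q) ^ q = (1 + fps_X :: 'a fps)"
    using assms by (simp add: fps_binomial_power fps_binomial_1)
  also have "(1 + fps_X) oo (F - 1) = F"
    using assms by (simp add: fps_compose_add_distrib)
  finally show ?thesis .
qed

lemma integral_fps_root:
  fixes F G :: "'p::prime_card padic_int fps" and H :: "'p padic fps"
  assumes root: "H ^ CARD('p) ^ r = fps_to_fract F"
    and H0: "H $ 0 = 1" and G0: "G $ 0 = 1"
    and cong: "of_nat CARD('p) ^ Suc r dvd F - G ^ CARD('p) ^ r"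
  shows "integral_fps H"
proof -
  let ?p = "of_nat CARD('p) :: 'p padic_int"
  let ?q = "CARD('p) ^ r"
  have "\<exists>c. H $ n = to_fract (G $ n + ?p * c)" for n
  proof (induction n rule: less_induct)
    case (less n)
    show ?case
    proof (cases "n = 0")
      case True
      then show ?thesis using H0 G0 by (intro exI[of _ 0]) simp
    next
      case False
      obtain c where c: "\<And>i. i < n \<Longrightarrow> H $ i = to_fract (G $ i + ?p * c i)"
        using less by metis
      \<comment> \<open>An integral lift of the cutoff of \<open>H\<close>, congruent modulo
        \<open>p\<close> to the cutoff of \<open>G\<close>.\<close>
      define D where "D = Abs_fps (\<lambda>i. if i < n then G $ i + ?p * c i else 0)"
      have D: "fps_cutoff n H = fps_to_fract D"
        by (rule fps_ext) (simp add: D_def c)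
      have "?p dvd (D - fps_cutoff n G) $ i" for i
        by (simp add: D_def)
      then have "of_nat CARD('p) dvd D - fps_cutoff n G"
        by (subst fps_of_nat_dvd_iff) blast
      then have "of_nat CARD('p) ^ Suc r dvd D ^ ?q - fps_cutoff n G ^ ?q"
        by (rule power_dvd_diff_power_prime_power)
      then obtain d where d: "(D ^ ?q) $ n - (fps_cutoff n G ^ ?q) $ n = ?p ^ Suc r * d"
        unfolding fps_of_nat_power_dvd_iff by (metis dvdE fps_sub_nth)
      obtain e where e: "F $ n - (G ^ ?q) $ n = ?p ^ Suc r * e"
        using cong unfolding fps_of_nat_power_dvd_iff by (metis dvdE fps_sub_nth)
      have "to_fract (F $ n) = of_nat ?q * H $ n + to_fract ((D ^ ?q) $ n)"
        using fps_power_nth_cutoff[OF H0, of n ?q] False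
        by (simp add: root D flip: fps_to_fract_power)
      then have "of_nat ?q * H $ n = to_fract (F $ n - (D ^ ?q) $ n)"
        by simp
      also have "F $ n - (D ^ ?q) $ n = of_nat ?q * (G $ n + ?p * (e - d))"
        using d e fps_power_nth_cutoff[OF G0, of n ?q] False by (simp add: algebra_simps)
      finally have "of_nat ?q * H $ n = of_nat ?q * to_fract (G $ n + ?p * (e - d))"
        by (simp only: to_fract_mult to_fract_of_nat)
      then have "H $ n = to_fract (G $ n + ?p * (e - d))" by simp
      then show ?thesis by blast
    qed
  qed
  then show ?thesis unfolding integral_fps_def by blast
qed

theorem theorem1:
  fixes a :: "nat \<Rightarrow> 'p::prime_card padic_int" and p r :: nat
  assumes "p = CARD('p)" and "r > 0"
  shows "integral_fps (fps_powr (one_plus_series a 1) (1 / of_nat p ^ r)) \<longleftrightarrow>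
         fps_cong (one_plus_series a 1) (one_plus_series a (p ^ r) ^ p ^ r) (r + 1)"
proof -
  let ?q = "CARD('p) ^ r"
  define S where "S d = Abs_fps (\<lambda>n. if n = 0 then 1 else a (n * d))" for d
  define H where "H = fps_powr (one_plus_series a 1) (1 / of_nat ?q)"
  have S: "one_plus_series a d = fps_to_fract (S d)" for d
    by (rule fps_ext) (simp add: S_def one_plus_series_def)
  have root: "H ^ ?q = fps_to_fract (S 1)"
    unfolding H_def S by (rule fps_powr_inverse_power) (simp_all add: S_def)
  have "integral_fps H \<longleftrightarrow> of_nat CARD('p) ^ Suc r dvd S 1 - S ?q ^ ?q"
  proof
    assume "integral_fps H"
    then obtain A where "H = fps_to_fract A" by (auto simp: integral_fps_iff)
    with root have A: "A ^ ?q = S 1" by (simp flip: fps_to_fract_power)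
    \<comment> \<open>Coefficient n of \<open>S ?q\<close> is coefficient \<open>n * ?q\<close> of
      \<open>S 1 = A ^ ?q\<close>, also for n = 0, where both are 1.\<close>
    have "of_nat CARD('p) dvd (S ?q - A) $ n" for n
      using frobenius_fps_padic_int[of A r n] by (simp add: A) (simp add: S_def split: if_splits)
    then have "of_nat CARD('p) dvd S ?q - A"
      by (subst fps_of_nat_dvd_iff) blast
    then have "of_nat CARD('p) dvd A - S ?q"
      by (metis dvd_minus_iff minus_diff_eq)
    then show "of_nat CARD('p) ^ Suc r dvd S 1 - S ?q ^ ?q"
      unfolding A[symmetric] by (rule power_dvd_diff_power_prime_power)
  next
    have "H $ 0 = 1" by (simp add: H_def fps_powr_def fps_compose_nth)
    moreover have "S ?q $ 0 = 1" by (simp add: S_def)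
    moreover assume "of_nat CARD('p) ^ Suc r dvd S 1 - S ?q ^ ?q"
    ultimately show "integral_fps H" by (rule integral_fps_root[OF root])
  qed
  then show ?thesis
    using assms by (simp add: H_def S fps_cong_to_fract_iff flip: fps_to_fract_power)
qed

end
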